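(* Let $P$ be the transition matrix of a finite Markov chain on the state space $\mathbb{S}$ with invariant distribution $\mu$ and initial distribution $\mu^{(0)}$, and let $f:\mathbb{S}\to\mathbb{R}^m$. Suppose that (1) $P$ is reversible with spectral gap $g$; (2) $\mathrm{E}f=\sum_{s}\mu_s f(s)=0$; (3) $\|f\|_\infty\le L$, where $L>0$; and (4) $\sigma^2(f)\le\sigma^2$. Then for every $\varepsilon>0$ and every integer $N\ge 1$, $$\Pr\{|S_N|\ge\varepsilon N\}\le 3\,\|\mu^{(0)}/\mu\|\,2^{m/2}\,e^{-\frac{1}{8k}\varepsilon^2N},$$ where $$k=\sigma^2\left(\frac12+\frac1g\right)+L^2\,\frac{192}{125}\,\frac{g}{\log^2[1+g/2]}.$$
   Context: Setting. $\mathbb{S}$ is a finite set with at least two elements, $P=(P_{st})_{s,t\in\mathbb{S}}$ is a stochastic matrix and $\mu$ is its invariant distribution, with $\mu_s>0$ for all $s$. Reversible means $\mu_sP_{st}=\mu_tP_{ts}$ for all $s,t$; then all eigenvalues of $P$ are real, written $\lambda_0=1>\lambda_1\ge\lambda_2\ge\dots\ge\lambda_{|\mathbb{S}|-1}\ge-1$ (so it is assumed that $\lambda_1<1$), and the spectral gap is $g=1-\lambda_1$. $\mathbb{R}^m$ carries its scalar product $\langle\cdot,\cdot\rangle$ and norm $|\cdot|$. $\log$ is the natural logarithm, and $\log^2 x=(\log x)^2$. $\mathrm{E}$ denotes expectation with respect to $\mu$. $\|f\|_\infty=\sup_s|f(s)|$, and the principal variance of $f$ is $\sigma^2(f)=\sup_{|u|=1}\sum_s\mu_s\langle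 f(s),u\rangle^2$. The quantity $\|\mu^{(0)}/\mu\|$ is the nonnegative square root of $\mathrm{E}[(\mu^{(0)}(s)/\mu(s))^2]=\sum_s(\mu^{(0)}_s)^2/\mu_s$. The chain $s_0,s_1,s_2,\dots$ starts with $s_0$ distributed according to $\mu^{(0)}$ (an arbitrary probability distribution on $\mathbb{S}$) and moves with transition matrix $P$; $S_N=\sum_{t=1}^Nf(s_t)$, and $\Pr$ is the law of this chain. *)

theory Defs
  imports "HOL-Probability.Probability" "HOL-Computational_Algebra.Polynomial"
begin

text \<open>Matrices and vectors indexed by a finite state space are functions on a type of class
  \<^class>\<open>finite\<close>.\<close>

definition probability_vector :: "('s::finite \<Rightarrow> real) \<Rightarrow> bool" where
  "probability_vector \<nu> \<longleftrightarrow> (\<forall>s. 0 \<le> \<nu> s) \<and> (\<Sum>s\<in>UNIV. \<nu> s) = 1"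

definition stochastic_matrix :: "('s::finite \<Rightarrow> 's \<Rightarrow> real) \<Rightarrow> bool" where
  "stochastic_matrix P \<longleftrightarrow> (\<forall>s. probability_vector (P s))"

definition invariant_distribution :: "('s::finite \<Rightarrow> 's \<Rightarrow> real) \<Rightarrow> ('s \<Rightarrow> real) \<Rightarrow> bool" where
  "invariant_distribution P \<mu> \<longleftrightarrow>
     probability_vector \<mu> \<and> (\<forall>t. (\<Sum>s\<in>UNIV. \<mu> s * P s t) = \<mu> t)"

definition reversible :: "('s::finite \<Rightarrow> 's \<Rightarrow> real) \<Rightarrow> ('s \<Rightarrow> real) \<Rightarrow> bool" where
  "reversible P \<mu> \<longleftrightarrow> (\<forall>s t. \<mu> s * P s t = \<mu> t * P t s)"

definition characteristic_polynomial :: "('s::finite \<Rightarrow> 's \<Rightarrow> real) \<Rightarrow> real poly" where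
  "characteristic_polynomial P = det (\<chi> s t. (if s = t then [:0, 1:] else 0) - [:P s t:])"

text \<open>The real eigenvalues \<open>\<lambda>\<^sub>0 \<ge> \<lambda>\<^sub>1 \<ge> \<dots>\<close>, repeated according to algebraic multiplicity.  For a
  matrix that is reversible with respect to a positive vector, all eigenvalues are real, so that
  the list has length \<open>CARD('s)\<close>.\<close>

definition decreasing_eigenvalues :: "('s::finite \<Rightarrow> 's \<Rightarrow> real) \<Rightarrow> real list" where
  "decreasing_eigenvalues P = rev (sorted_list_of_multiset (proots (characteristic_polynomial P)))"

definition spectral_gap :: "('s::finite \<Rightarrow> 's \<Rightarrow> real) \<Rightarrow> real" where
  "spectral_gap P = 1 - decreasing_eigenvalues P ! 1"

definition mean :: "('s::finite \<Rightarrow> real) \<Rightarrow> ('s \<Rightarrow> 'v::real_vector) \<Rightarrow> 'v" where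
  "mean \<mu> h = (\<Sum>s\<in>UNIV. \<mu> s *\<^sub>R h s)"

definition sup_norm :: "('s::finite \<Rightarrow> 'v::real_normed_vector) \<Rightarrow> real" where
  "sup_norm f = (SUP s. norm (f s))"

definition principal_variance :: "('s::finite \<Rightarrow> real) \<Rightarrow> ('s \<Rightarrow> 'v::euclidean_space) \<Rightarrow> real" where
  "principal_variance \<mu> f = (SUP u\<in>{u. norm u = 1}. \<Sum>s\<in>UNIV. \<mu> s * (f s \<bullet> u)\<^sup>2)"

definition density_norm :: "('s::finite \<Rightarrow> real) \<Rightarrow> ('s \<Rightarrow> real) \<Rightarrow> real" where
  "density_norm \<mu>0 \<mu> = sqrt (mean \<mu> (\<lambda>s. (\<mu>0 s / \<mu> s)\<^sup>2))"

definition markov_chain ::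
  "'w measure \<Rightarrow> (nat \<Rightarrow> 'w \<Rightarrow> 's::finite) \<Rightarrow> ('s \<Rightarrow> real) \<Rightarrow> ('s \<Rightarrow> 's \<Rightarrow> real) \<Rightarrow> bool" where
  "markov_chain M X \<mu>0 P \<longleftrightarrow>
     prob_space M \<and>
     (\<forall>n. X n \<in> measurable M (count_space UNIV)) \<and>
     (\<forall>s. measure M {\<omega> \<in> space M. X 0 \<omega> = s} = \<mu>0 s) \<and>
     (\<forall>n x. measure M {\<omega> \<in> space M. \<forall>i\<le>n. X i \<omega> = x i} > 0 \<longrightarrow>
        cond_prob M (\<lambda>\<omega>. X (Suc n) \<omega> = x (Suc n)) (\<lambda>\<omega>. \<forall>i\<le>n. X i \<omega> = x i) = P (x n) (x (Suc n)))"

lemma poly_det: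
  fixes A :: "real poly ^ 'n ^ 'n"
  shows "poly (det A) x = det (\<chi> i j. poly (A $ i $ j) x)"
  by (simp add: det_def poly_sum poly_prod)

lemma poly_characteristic_polynomial_eq_0_iff:
  fixes P :: "'s::finite \<Rightarrow> 's \<Rightarrow> real"
  shows "poly (characteristic_polynomial P) x = 0 \<longleftrightarrow>
    (\<exists>v. (\<exists>s. v s \<noteq> 0) \<and> (\<forall>s. (\<Sum>t\<in>UNIV. P s t * v t) = x * v s))"
proof -
  define A :: "real ^ 's ^ 's" where "A = (\<chi> s t. (if s = t then x else 0) - P s t)"
  have "poly (characteristic_polynomial P) x = det A"
    unfolding characteristic_polynomial_def poly_det A_def
    by (intro arg_cong[of _ _ det]) (simp add: vec_eq_iff)
  also have "det A = 0 \<longleftrightarrow> \<not> invertible A"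
    by (simp add: invertible_det_nz)
  also have "\<dots> \<longleftrightarrow> (\<exists>v. A *v v = 0 \<and> v \<noteq> 0)"
    using invertible_left_inverse[of A] matrix_left_invertible_ker[of A] by auto
  also have "\<dots> \<longleftrightarrow> (\<exists>v. (\<exists>s. v $ s \<noteq> 0) \<and> (\<forall>s. (\<Sum>t\<in>UNIV. P s t * v $ t) = x * v $ s))"
  proof -
    have "(A *v v) $ s = x * v $ s - (\<Sum>t\<in>UNIV. P s t * v $ t)" for v s
      by (simp add: A_def matrix_vector_mult_def left_diff_distrib sum_subtractf if_distrib
          [of "\<lambda>c. c * _"] cong: if_cong)
    then have "A *v v = 0 \<longleftrightarrow> (\<forall>s. (\<Sum>t\<in>UNIV. P s t * v $ t) = x * v $ s)" for v
      by (auto simp: vec_eq_iff)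
    moreover have "v \<noteq> 0 \<longleftrightarrow> (\<exists>s. v $ s \<noteq> 0)" for v :: "real ^ 's"
      by (simp add: vec_eq_iff)
    ultimately show ?thesis by blast
  qed
  also have "\<dots> \<longleftrightarrow> (\<exists>v. (\<exists>s. v s \<noteq> 0) \<and> (\<forall>s. (\<Sum>t\<in>UNIV. P s t * v t) = x * v s))"
    (is "?L \<longleftrightarrow> ?R")
  proof
    assume ?R
    then obtain v where "\<exists>s. v s \<noteq> 0" "\<forall>s. (\<Sum>t\<in>UNIV. P s t * v t) = x * v s" by blast
    then show ?L by (intro exI[of _ "\<chi> s. v s"]) simp
  qed blast
  finally show ?thesis .
qed

lemma characteristic_polynomial_nonzero: "characteristic_polynomial P \<noteq> 0"
proof
  assume 0: "characteristic_polynomial P = 0"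
  define A :: "real ^ 'a ^ 'a" where "A = (\<chi> s t. P s t)"
  obtain B where B: "norm (A *v v) \<le> norm v * B" for v
    using bounded_linear.bounded[OF matrix_vector_mul_bounded_linear[of A]] by blast
  obtain v where v: "\<exists>s. v s \<noteq> 0" "\<forall>s. (\<Sum>t\<in>UNIV. P s t * v t) = (\<bar>B\<bar> + 1) * v s"
    using poly_characteristic_polynomial_eq_0_iff[of P "\<bar>B\<bar> + 1"] 0 by auto
  define w :: "real ^ 'a" where "w = (\<chi> s. v s)"
  have "w \<noteq> 0" using v(1) by (simp add: w_def vec_eq_iff)
  moreover have "A *v w = (\<bar>B\<bar> + 1) *\<^sub>R w"
    using v(2) by (simp add: A_def w_def vec_eq_iff matrix_vector_mult_def)
  then have "(\<bar>B\<bar> + 1) * norm w \<le> B * norm w" using B[of w] by (simp add: mult.commute)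
  moreover have "B * norm w \<le> \<bar>B\<bar> * norm w" by (simp add: mult_right_mono)
  ultimately show False using zero_less_norm_iff[of w] by (simp only: distrib_right) linarith
qed

lemma set_decreasing_eigenvalues:
  "set (decreasing_eigenvalues P) =
    {x. \<exists>v. (\<exists>s. v s \<noteq> 0) \<and> (\<forall>s. (\<Sum>t\<in>UNIV. P s t * v t) = x * v s)}"
  using poly_characteristic_polynomial_eq_0_iff[of P]
  by (auto simp: decreasing_eigenvalues_def characteristic_polynomial_nonzero)

end

(* For a vector \<theta> put h s = \<theta> \<bullet> f s and b = L |\<theta>|.  The moment E exp (\<theta> \<bullet> S_N) is the pairing of the
   initial distribution with T^N 1, where T = P exp(h) is self-adjoint for the weight \<mu> exp(h).  Its
   form is w \<mapsto> <w, P w> for w = exp(h) a, which the spectral gap bounds by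
   (1 - g) E w^2 + g (E w)^2.  By Cauchy-Schwarz this is at most exp(\<kappa>) E (exp(-h) w^2) as soon as
   E (g / (g + \<kappa> - h)) \<le> 1, and convexity in h together with E h = 0 gives this for
   \<kappa> = b^2 / g.  Hence E exp (\<theta> \<bullet> S_N) \<le> 3 ||\<mu>0/\<mu>|| exp (k N |\<theta>|^2), because 2 L^2 / g \<le> k by
   ln (1 + x) \<le> x.  Integrating over \<theta> with a Gaussian weight yields the factor 2^(m/2), and
   Markov's inequality concludes. *)
theory Submission
  imports Defs
begin

section \<open>The spectral gap of a reversible chain\<close>

locale reversible_chain =
  fixes P :: "'s::finite \<Rightarrow> 's \<Rightarrow> real" and \<mu> :: "'s \<Rightarrow> real"
  assumes P_nonneg: "0 \<le> P s t"
    and P_row: "(\<Sum>t\<in>UNIV. P s t) = 1"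
    and mu_pos: "0 < \<mu> s"
    and mu_total: "(\<Sum>s\<in>UNIV. \<mu> s) = 1"
    and detailed_balance: "\<mu> s * P s t = \<mu> t * P t s"
begin

definition op :: "('s \<Rightarrow> real) \<Rightarrow> 's \<Rightarrow> real" where
  "op w s = (\<Sum>t\<in>UNIV. P s t * w t)"

text \<open>The scalar product of \<open>L^2(\<mu>)\<close>. Mean zero is expressed as
  \<open>ip (\<lambda>_. 1) w = 0\<close> throughout.\<close>

definition ip :: "('s \<Rightarrow> real) \<Rightarrow> ('s \<Rightarrow> real) \<Rightarrow> real" where
  "ip v w = (\<Sum>s\<in>UNIV. \<mu> s * v s * w s)"

lemma ip_commute: "ip v w = ip w v"
  by (simp add: ip_def mult_ac)

lemma ip_add: "ip (\<lambda>s. v s + w s) u = ip v u + ip w u"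
  by (simp add: ip_def algebra_simps sum.distrib)

lemma ip_scale: "ip (\<lambda>s. c * v s) u = c * ip v u"
  by (simp add: ip_def sum_distrib_left mult_ac)

lemma ip_add_right: "ip u (\<lambda>s. v s + w s) = ip u v + ip u w"
  by (simp add: ip_def algebra_simps sum.distrib)

lemma ip_scale_right: "ip u (\<lambda>s. c * v s) = c * ip u v"
  by (simp add: ip_def sum_distrib_left mult_ac)

lemmas ip_simps = ip_add ip_scale ip_add_right ip_scale_right

lemma op_add: "op (\<lambda>s. v s + w s) = (\<lambda>s. op v s + op w s)"
  by (simp add: op_def algebra_simps sum.distrib fun_eq_iff)

lemma op_scale: "op (\<lambda>s. c * v s) = (\<lambda>s. c * op v s)"
  by (simp add: op_def sum_distrib_left mult_ac fun_eq_iff)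

lemma op_const: "op (\<lambda>s. c) = (\<lambda>s. c)"
  by (simp add: op_def P_row fun_eq_iff flip: sum_distrib_right)

lemma ip_op: "ip v (op w) = (\<Sum>s\<in>UNIV. \<Sum>t\<in>UNIV. \<mu> s * P s t * v s * w t)"
  by (simp add: ip_def op_def sum_distrib_left mult_ac)

text \<open>Detailed balance makes \<open>\<mu> s * P s t\<close> symmetric in the two
  states.\<close>

lemma ip_op_commute: "ip v (op w) = ip w (op v)"
proof -
  have "ip v (op w) = (\<Sum>t\<in>UNIV. \<Sum>s\<in>UNIV. \<mu> s * P s t * v s * w t)"
    unfolding ip_op by (rule sum.swap)
  also have "\<dots> = ip w (op v)"
    unfolding ip_op by (intro sum.cong refl) (simp add: detailed_balance mult_ac)
  finally show ?thesis .
qed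

lemma ip_self_nonneg: "0 \<le> ip w w"
  unfolding ip_def using mu_pos by (intro sum_nonneg) (simp add: less_imp_le mult.assoc)

lemma ip_self_eq_0: "ip w w = 0 \<longleftrightarrow> w = (\<lambda>_. 0)"
proof -
  have "ip w w = 0 \<longleftrightarrow> (\<forall>s\<in>UNIV. \<mu> s * w s * w s = 0)"
    unfolding ip_def using mu_pos
    by (intro sum_nonneg_eq_0_iff) (simp_all add: less_imp_le mult.assoc)
  then show ?thesis using mu_pos by (auto simp: fun_eq_iff less_imp_neq[THEN not_sym])
qed

lemma ip_one_op: "ip (\<lambda>_. 1) (op w) = ip (\<lambda>_. 1) w"
  by (subst ip_op_commute) (simp add: op_const ip_commute)

text \<open>A weighted sum of the squares of \<open>w s + c * w t\<close> expands to twice the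
  claimed quantity. The case \<open>c = - 1\<close> bounds the spectrum by 1 from above,
  \<open>c = 1\<close> bounds it by -1 from below.\<close>

lemma dirichlet_nonneg:
  assumes "\<bar>c\<bar> = 1"
  shows "0 \<le> ip w w + c * ip w (op w)"
proof -
  have c: "c * c = 1" using assms by (metis abs_mult_self_eq mult_1)
  have 1: "(\<Sum>s\<in>UNIV. \<Sum>t\<in>UNIV. \<mu> s * P s t * (w s * w s)) = ip w w"
    by (simp add: ip_def P_row mult.assoc flip: sum_distrib_left sum_distrib_right)
  have 2: "(\<Sum>s\<in>UNIV. \<Sum>t\<in>UNIV. \<mu> s * P s t * (w t * w t)) = ip w w"
    by (subst sum.swap, subst 1[symmetric], intro sum.cong refl) (simp add: detailed_balance)
  have "0 \<le> (\<Sum>s\<in>UNIV. \<Sum>t\<in>UNIV. \<mu> s * P s t * (w s + c * w t)\<^sup>2)"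
    by (intro sum_nonneg mult_nonneg_nonneg P_nonneg less_imp_le[OF mu_pos] zero_le_power2)
  also have "\<dots> = (\<Sum>s\<in>UNIV. \<Sum>t\<in>UNIV. \<mu> s * P s t * (w s * w s)
      + 2 * c * (\<mu> s * P s t * w s * w t) + (c * c) * (\<mu> s * P s t * (w t * w t)))"
    by (intro sum.cong refl) (simp add: power2_eq_square algebra_simps)
  also have "\<dots> = ip w w + 2 * c * ip w (op w) + c * c * ip w w"
    by (simp only: sum.distrib sum_distrib_left[symmetric] 1 2 ip_op)
  finally show ?thesis by (simp add: c)
qed

text \<open>By compactness the Rayleigh quotient attains its maximum over mean-zero functions, and
  the first variation at the maximizer is the eigenvalue equation. This gives the top of the
  spectrum off the constants without diagonalizing \<open>P\<close>.\<close>

lemma rayleigh_maximizer: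
  assumes "CARD('s) \<ge> 2"
  obtains v l where "v \<noteq> (\<lambda>_. 0)" "ip (\<lambda>_. 1) v = 0" "op v = (\<lambda>s. l * v s)"
    "\<forall>w. ip (\<lambda>_. 1) w = 0 \<longrightarrow> ip w (op w) \<le> l * ip w w"
proof -
  \<comment> \<open>The sphere is the Euclidean one, not that of \<open>ip\<close>; this is harmless
    because \<open>q\<close> is invariant under scaling.\<close>
  define S where "S = {x :: real^'s. norm x = 1 \<and> ip (\<lambda>_. 1) (($) x) = 0}"
  define q where "q w = ip w (op w) / ip w w" for w
  have S_eq: "S = sphere 0 1 \<inter> {x. ip (\<lambda>_. 1) (($) x) = 0}"
    by (auto simp: S_def)
  have "compact S" unfolding S_eq
    by (intro compact_Int_closed compact_sphere closed_Collect_eq)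
      (auto simp: ip_def intro!: continuous_intros)
  have q_scale: "q (\<lambda>s. c * w s) = q w" if "c \<noteq> 0" for c w
    using that by (simp add: q_def op_scale ip_simps)
  have normalize: "\<exists>x\<in>S. q (($) x) = q w" if w: "w \<noteq> (\<lambda>_. 0)" "ip (\<lambda>_. 1) w = 0" for w
  proof
    define y :: "real^'s" where "y = (\<chi> s. w s)"
    have "y \<noteq> 0" using w by (auto simp: y_def vec_eq_iff fun_eq_iff)
    have *: "($) (inverse (norm y) *\<^sub>R y) = (\<lambda>s. inverse (norm y) * w s)"
      by (simp add: y_def fun_eq_iff)
    show "q (($) (inverse (norm y) *\<^sub>R y)) = q w"
      unfolding * using \<open>y \<noteq> 0\<close> by (intro q_scale) simp
    show "inverse (norm y) *\<^sub>R y \<in> S"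
      using \<open>y \<noteq> 0\<close> w(2) unfolding S_def mem_Collect_eq *
      by (simp add: ip_simps)
  qed
  obtain a b :: 's where "a \<noteq> b"
    using assms by (metis card_2_iff' One_nat_def card_le_Suc0_iff_eq finite not_less_eq_eq numeral_2_eq_2 UNIV_I)
  \<comment> \<open>Opposite weights \<open>1 / \<mu>\<close> on two states give a nonzero function
    of mean zero, so \<open>S\<close> is nonempty.\<close>
  define w0 where "w0 = (\<lambda>s. if s = a then 1 / \<mu> a else if s = b then - (1 / \<mu> b) else 0)"
  have w0: "w0 \<noteq> (\<lambda>_. 0)" "ip (\<lambda>_. 1) w0 = 0"
  proof -
    show "w0 \<noteq> (\<lambda>_. 0)" using mu_pos[of a] by (auto simp: w0_def fun_eq_iff)
    have "ip (\<lambda>_. 1) w0 = (\<Sum>s\<in>{a,b}. \<mu> s * w0 s)"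
      unfolding ip_def by (intro sum.mono_neutral_cong_right) (auto simp: w0_def)
    also have "\<dots> = 0" using \<open>a \<noteq> b\<close> mu_pos[of a] mu_pos[of b] by (simp add: w0_def)
    finally show "ip (\<lambda>_. 1) w0 = 0" .
  qed
  have "S \<noteq> {}" using normalize[OF w0] by auto
  moreover have "continuous_on S (\<lambda>x. q (($) x))"
  proof -
    have "ip (($) x) (($) x) \<noteq> 0" if "x \<in> S" for x
      using that unfolding ip_self_eq_0 by (auto simp: S_def fun_eq_iff vec_eq_iff[of x 0, simplified, symmetric])
    then show ?thesis unfolding q_def
      by (intro continuous_on_divide) (auto simp: ip_def op_def intro!: continuous_intros)
  qed
  ultimately obtain x where x: "x \<in> S" "\<And>y. y \<in> S \<Longrightarrow> q (($) y) \<le> q (($) x)"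
    using continuous_attains_sup[OF \<open>compact S\<close>] by blast
  define v where "v = ($) x"
  define l where "l = q v"
  have v0: "v \<noteq> (\<lambda>_. 0)" using x(1) by (auto simp: v_def S_def fun_eq_iff vec_eq_iff[of x 0, simplified, symmetric])
  have v1: "ip (\<lambda>_. 1) v = 0" using x(1) by (simp add: v_def S_def)
  have upper: "ip w (op w) \<le> l * ip w w" if "ip (\<lambda>_. 1) w = 0" for w
  proof (cases "w = (\<lambda>_. 0)")
    case True
    then show ?thesis by (simp add: ip_def)
  next
    case False
    then have "q w \<le> l" using normalize[OF False that] x(2) unfolding l_def v_def by metis
    moreover have "0 < ip w w" using False ip_self_nonneg[of w] ip_self_eq_0[of w] by linarith
    ultimately show ?thesis by (simp add: q_def divide_simps)
  qed
  \<comment> \<open>The residual of the eigenvalue equation, which also serves as the direction in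
    which maximality is tested.\<close>
  define u where "u = (\<lambda>s. op v s + (- l) * v s)"
  have "ip v v \<noteq> 0" using v0 by (simp add: ip_self_eq_0)
  then have eq: "ip v (op v) = l * ip v v" by (simp add: l_def q_def)
  have u1: "ip (\<lambda>_. 1) u = 0"
    unfolding u_def ip_simps using v1 by (simp add: ip_one_op)
  have uu: "ip u (op v) - l * ip u v = ip u u"
    unfolding u_def ip_simps by (simp add: ip_commute[of "op v" v] algebra_simps)
  \<comment> \<open>Maximality at \<open>v + c u\<close>: the terms of order zero cancel by
    \<open>eq\<close>, and \<open>uu\<close> evaluates the linear one.\<close>
  have *: "2 * c * ip u u \<le> c\<^sup>2 * (l * ip u u - ip u (op u))" for c
  proof -
    let ?w = "\<lambda>s. v s + c * u s"
    have "ip (\<lambda>_. 1) ?w = 0"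
      using u1 v1 by (simp add: ip_simps)
    from upper[OF this] have "ip v (op v) + 2 * c * ip u (op v) + c\<^sup>2 * ip u (op u)
        \<le> l * (ip v v + 2 * c * ip u v + c\<^sup>2 * ip u u)"
      by (simp add: op_add op_scale ip_simps ip_op_commute[of v u] ip_commute[of v u]
          power2_eq_square algebra_simps)
    then show ?thesis using eq uu by (simp add: algebra_simps)
  qed
  have "ip u u = 0"
  proof (rule ccontr)
    assume "ip u u \<noteq> 0"
    then have pos: "0 < ip u u" using ip_self_nonneg[of u] by simp
    \<comment> \<open>The summand 1 keeps \<open>K\<close> positive. With
      \<open>c = ip u u / K\<close> the quadratic term is at most half of the linear one, a
      contradiction.\<close>
    define K where "K = \<bar>l * ip u u - ip u (op u)\<bar> + 1"
    have "K > 0" by (simp add: K_def add_nonneg_pos)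
    define c where "c = ip u u / K"
    have "c > 0" using pos \<open>K > 0\<close> by (simp add: c_def)
    have "2 * c * ip u u \<le> c\<^sup>2 * K"
      by (rule order_trans[OF *], rule mult_left_mono) (auto simp: K_def)
    also have "\<dots> = c * ip u u" using \<open>K > 0\<close> by (simp add: c_def power2_eq_square)
    finally show False using \<open>c > 0\<close> pos by simp
  qed
  then have "op v = (\<lambda>s. l * v s)" by (simp add: ip_self_eq_0 u_def fun_eq_iff)
  with v0 v1 upper show ?thesis by (intro that) auto
qed

end

section \<open>Multiplicities in the list of eigenvalues\<close>

lemma decreasing_eigenvalues_nth_1_ge:
  assumes "size (filter_mset (\<lambda>y. x \<le> y) (proots (characteristic_polynomial P))) \<ge> 2"
  shows "x \<le> decreasing_eigenvalues P ! 1"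
proof (rule ccontr)
  define xs where "xs = decreasing_eigenvalues P"
  have sorted: "sorted_wrt (\<ge>) xs"
    unfolding xs_def decreasing_eigenvalues_def by (simp add: sorted_wrt_rev)
  have mset: "mset xs = proots (characteristic_polynomial P)"
    by (simp add: xs_def decreasing_eigenvalues_def)
  assume "\<not> x \<le> decreasing_eigenvalues P ! 1"
  then have less: "xs ! 1 < x" by (simp add: xs_def)
  \<comment> \<open>Indices start at 0, so entry 1 is the second largest. If it lies below
    \<open>x\<close>, only entry 0 can reach \<open>x\<close>.\<close>
  have "filter ((\<le>) x) xs = filter ((\<le>) x) (take 1 xs) @ filter ((\<le>) x) (drop 1 xs)"
    by (metis append_take_drop_id filter_append)
  also have "filter ((\<le>) x) (drop 1 xs) = []"
  proof -
    have "xs ! j < x" if "1 \<le> j" "j < length xs" for j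
      using sorted_wrt_nth_less[OF sorted, of 1 j] less that by (cases "j = 1") auto
    then show ?thesis by (auto simp: filter_empty_conv in_set_conv_nth not_le)
  qed
  finally have "length (filter ((\<le>) x) xs) \<le> 1"
    by (metis append_Nil2 length_filter_le length_take min.cobounded2 order_trans)
  then show False using assms by (simp flip: mset mset_filter)
qed

lemma sum_const_poly: "(\<Sum>i\<in>A. [:h i:]) = [:\<Sum>i\<in>A. h i:]"
  by (induction A rule: infinite_finite_induct) simp_all

lemma prod_const_poly:
  fixes h :: "'a \<Rightarrow> 'b::comm_semiring_1"
  shows "(\<Prod>i\<in>A. [:h i:]) = [:\<Prod>i\<in>A. h i:]"
  by (induction A rule: infinite_finite_induct) (simp_all add: one_pCons mult.commute)

text \<open>Geometric multiplicity two forces algebraic multiplicity two. After a change of basis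
  that puts \<open>v\<close> and \<open>w\<close> into two columns, both columns of the
  characteristic matrix are divisible by \<open>X - x\<close>. The nonzero minor expresses linear
  independence.\<close>

lemma two_eigenvectors_dvd_characteristic_polynomial:
  fixes P :: "'s::finite \<Rightarrow> 's \<Rightarrow> real"
  assumes eigen: "\<And>s. (\<Sum>t\<in>UNIV. P s t * v t) = x * v s" "\<And>s. (\<Sum>t\<in>UNIV. P s t * w t) = x * w s"
    and minor: "v a * w b \<noteq> v b * w a"
  shows "[:- x, 1:]\<^sup>2 dvd characteristic_polynomial P"
proof -
  have "a \<noteq> b" using minor by auto
  \<comment> \<open>The identity matrix with columns \<open>a\<close> and \<open>b\<close> replaced
    by \<open>v\<close> and \<open>w\<close>; its determinant is the minor up to sign, hence
    nonzero.\<close>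
  define Q :: "real^'s^'s" where
    "Q = (\<chi> s t. if t = a then v s else if t = b then w s else if s = t then 1 else 0)"
  have "det Q \<noteq> 0"
  proof -
    have "z = 0" if "Q *v z = 0" for z
    proof -
      have *: "(Q *v z) $ s = v s * z $ a + w s * z $ b + (if s = a \<or> s = b then 0 else z $ s)" for s
      proof -
        have "(Q *v z) $ s = Q $ s $ a * z $ a + (Q $ s $ b * z $ b + (\<Sum>t\<in>UNIV-{a}-{b}. Q $ s $ t * z $ t))"
          unfolding matrix_vector_mult_def
          using \<open>a \<noteq> b\<close> by (simp add: sum.remove[of UNIV a] sum.remove[of "UNIV - {a}" b])
        also have "(\<Sum>t\<in>UNIV-{a}-{b}. Q $ s $ t * z $ t) = (\<Sum>t\<in>UNIV-{a}-{b}. if s = t then z $ t else 0)"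
          by (intro sum.cong refl) (auto simp: Q_def)
        also have "\<dots> = (if s = a \<or> s = b then 0 else z $ s)" by (subst sum.delta') auto
        finally show ?thesis using \<open>a \<noteq> b\<close> by (simp add: Q_def)
      qed
      have A: "v a * z $ a + w a * z $ b = 0" using *[of a] that by simp
      have B: "v b * z $ a + w b * z $ b = 0" using *[of b] that by simp
      \<comment> \<open>Cramer's rule for the two by two system formed by rows \<open>a\<close> and
        \<open>b\<close>.\<close>
      have "w b * (v a * z $ a + w a * z $ b) - w a * (v b * z $ a + w b * z $ b) = 0"
        "v a * (v b * z $ a + w b * z $ b) - v b * (v a * z $ a + w a * z $ b) = 0"
        using A B by simp_all
      then have "(v a * w b - v b * w a) * z $ a = 0" "(v a * w b - v b * w a) * z $ b = 0"
        by (simp_all add: algebra_simps)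
      then have "z $ a = 0" "z $ b = 0" using minor by simp_all
      then show "z = 0" using * that by (auto simp: vec_eq_iff) (metis)
    qed
    then have "invertible Q"
      using invertible_left_inverse[of Q] matrix_left_invertible_ker[of Q] by blast
    then show ?thesis by (simp add: invertible_det_nz)
  qed
  define C :: "real poly^'s^'s" where "C = (\<chi> s t. (if s = t then [:0, 1:] else 0) - [:P s t:])"
  define R :: "real poly^'s^'s" where "R = (\<chi> s t. [:Q $ s $ t:])"
  have det_R: "det R = [:det Q:]"
    by (simp add: det_def R_def prod_const_poly of_int_poly sum_const_poly)
      (intro sum.cong refl mult.commute)
  \<comment> \<open>The transpose of \<open>C ** R\<close> with the factor \<open>X - x\<close>
    removed from rows \<open>a\<close> and \<open>b\<close>. Transposing allows the factors to be
    pulled out row by row.\<close>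
  define D :: "real poly^'s^'s" where
    "D = (\<chi> t s. if t = a then [:v s:] else if t = b then [:w s:] else (C ** R) $ s $ t)"
  have CR: "(C ** R) $ s $ a = [:- x, 1:] * [:v s:]" "(C ** R) $ s $ b = [:- x, 1:] * [:w s:]" for s
  proof -
    have gen: "(\<Sum>t\<in>UNIV. C $ s $ t * [:h t:]) = [:- x, 1:] * [:h s:]"
      if h: "\<And>s. (\<Sum>t\<in>UNIV. P s t * h t) = x * h s" for h :: "'s \<Rightarrow> real"
    proof -
      have "(\<Sum>t\<in>UNIV. C $ s $ t * [:h t:]) =
          (\<Sum>t\<in>UNIV. if s = t then [:0, 1:] * [:h t:] else 0) - (\<Sum>t\<in>UNIV. [:P s t * h t:])"
        unfolding sum_subtractf[symmetric] by (intro sum.cong refl) (simp add: C_def algebra_simps)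
      then show ?thesis by (simp add: sum_const_poly h)
    qed
    show "(C ** R) $ s $ a = [:- x, 1:] * [:v s:]" "(C ** R) $ s $ b = [:- x, 1:] * [:w s:]"
      using gen[OF eigen(1)] gen[OF eigen(2)] \<open>a \<noteq> b\<close>
      by (simp_all add: matrix_matrix_mult_def R_def Q_def)
  qed
  have "transpose (C ** R) = (\<chi> t. (if t = a \<or> t = b then [:- x, 1:] else 1) *s D $ t)"
    using \<open>a \<noteq> b\<close> by (auto simp: vec_eq_iff transpose_def D_def CR)
  then have "det (C ** R) = det (\<chi> t. (if t = a \<or> t = b then [:- x, 1:] else 1) *s D $ t)"
    by (metis det_transpose)
  also have "\<dots> = (\<Prod>t\<in>UNIV. if t = a \<or> t = b then [:- x, 1:] else 1) * det D"
    by (rule det_rows_mul[of _ "($) D", simplified])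
  also have "(\<Prod>t\<in>UNIV. if t = a \<or> t = b then [:- x, 1:] else 1) = (\<Prod>t\<in>{a,b}. [:- x, 1:])"
    by (intro prod.mono_neutral_cong_right) auto
  also have "\<dots> = [:- x, 1:]\<^sup>2" using \<open>a \<noteq> b\<close> by (simp add: power2_eq_square)
  finally have "[:- x, 1:]\<^sup>2 dvd det C * [:det Q:]"
    by (metis det_mul det_R dvd_triv_left)
  then have "[:- x, 1:]\<^sup>2 dvd det C"
    using \<open>det Q \<noteq> 0\<close> by (simp add: mult.commute[of "det C"] dvd_smult_iff)
  then show ?thesis by (simp add: characteristic_polynomial_def C_def)
qed

section \<open>The spectral gap as a bound on the quadratic form\<close>

context reversible_chain begin

text \<open>The maximum \<open>l\<close> of the Rayleigh quotient is an eigenvalue with a mean-zero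
  eigenvector. Together with the eigenvalue 1 of the constants it gives two roots that are at least
  \<open>l\<close>, so entry 1 of the list is at least \<open>l\<close>.\<close>

lemma rayleigh_le_second_eigenvalue:
  assumes card: "CARD('s) \<ge> 2" and w: "ip (\<lambda>_. 1) w = 0"
  shows "ip w (op w) \<le> decreasing_eigenvalues P ! 1 * ip w w"
proof -
  obtain v l where v: "v \<noteq> (\<lambda>_. 0)" "ip (\<lambda>_. 1) v = 0" "op v = (\<lambda>s. l * v s)"
    and max: "\<forall>w. ip (\<lambda>_. 1) w = 0 \<longrightarrow> ip w (op w) \<le> l * ip w w"
    by (rule rayleigh_maximizer[OF card])
  let ?p = "characteristic_polynomial P"
  have pos: "0 < ip v v" using v(1) ip_self_nonneg[of v] ip_self_eq_0[of v] by linarith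
  have "l \<le> 1" using dirichlet_nonneg[of "-1" v] pos by (simp add: v(3) ip_simps)
  have root: "poly ?p 1 = 0" "poly ?p l = 0"
  proof -
    show "poly ?p 1 = 0"
      unfolding poly_characteristic_polynomial_eq_0_iff
      by (intro exI[of _ "\<lambda>_. 1"]) (simp add: P_row)
    show "poly ?p l = 0"
      unfolding poly_characteristic_polynomial_eq_0_iff
      by (intro exI[of _ v] conjI) (use v(1) v(3) in \<open>simp_all add: op_def fun_eq_iff\<close>)
  qed
  \<comment> \<open>For \<open>l = 1\<close> the two roots coincide, and 1 has to be shown to be a
    double root; otherwise \<open>l\<close> and 1 are distinct roots.\<close>
  have "2 \<le> size (filter_mset ((\<le>) l) (proots ?p))"
  proof (cases "l = 1")
    case True
    \<comment> \<open>A nonzero function of mean zero is not constant, hence independent of the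
      constant eigenvector.\<close>
    obtain a b where ab: "v a \<noteq> v b"
    proof (rule ccontr)
      assume "\<not> thesis"
      define c where "c = v undefined"
      have "v s = c" for s using \<open>\<not> thesis\<close> that[of s undefined] by (auto simp: c_def)
      then have c: "v = (\<lambda>_. c)" by (rule ext)
      then have "ip (\<lambda>_. 1) v = c"
        by (simp add: ip_def mu_total flip: sum_distrib_right)
      then have "c = 0" using v(2) by simp
      then show False using c v(1) by simp
    qed
    have "[:- 1, 1:]\<^sup>2 dvd ?p"
      using ab v(3) True
      by (intro two_eigenvectors_dvd_characteristic_polynomial[of P "\<lambda>_. 1" 1 v b a])
        (auto simp: P_row op_def fun_eq_iff)
    then have "2 \<le> order 1 ?p"
      by (simp add: order_divides characteristic_polynomial_nonzero)
    then have "2 \<le> count (proots ?p) 1"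
      by (simp only: count_proots[OF characteristic_polynomial_nonzero])
    then have "2 \<le> count (filter_mset ((\<le>) l) (proots ?p)) 1"
      using True by simp
    from order_trans[OF this count_le_size] show ?thesis .
  next
    case False
    then have "{#l, 1#} \<subseteq># filter_mset ((\<le>) l) (proots ?p)"
      using root \<open>l \<le> 1\<close> characteristic_polynomial_nonzero[of P]
      by (simp add: insert_subset_eq_iff in_diff_count order_root)
    from size_mset_mono[OF this] show ?thesis by simp
  qed
  then have "l \<le> decreasing_eigenvalues P ! 1"
    by (rule decreasing_eigenvalues_nth_1_ge)
  from mult_right_mono[OF this ip_self_nonneg[of w]] show ?thesis
    using max[rule_format, OF w] by linarith
qed

text \<open>The spectrum lies above -1. The bound later allows \<open>b^2 / 2\<close> to be absorbed
  into \<open>b^2 / g\<close>.\<close>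

lemma spectral_gap_le_2:
  assumes card: "CARD('s) \<ge> 2"
  shows "spectral_gap P \<le> 2"
proof -
  obtain v where v: "v \<noteq> (\<lambda>_. 0)" "ip (\<lambda>_. 1) v = 0"
    by (rule rayleigh_maximizer[OF card])
  have pos: "0 < ip v v" using v(1) ip_self_nonneg[of v] ip_self_eq_0[of v] by linarith
  have "0 \<le> ip v v + ip v (op v)" using dirichlet_nonneg[of 1 v] by simp
  then have "- 1 * ip v v \<le> decreasing_eigenvalues P ! 1 * ip v v"
    using rayleigh_le_second_eigenvalue[OF card v(2)] by linarith
  then have "- 1 \<le> decreasing_eigenvalues P ! 1"
    using pos by (rule mult_right_le_imp_le)
  then show ?thesis by (simp add: spectral_gap_def)
qed

end

section \<open>The tilted operator\<close>

text \<open>The weight \<open>exp h\<close> sits at the arrival state, so that iterates collect the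
  times 1 to n and leave time 0 unweighted.\<close>

definition tilted_op :: "('s::finite \<Rightarrow> 's \<Rightarrow> real) \<Rightarrow> ('s \<Rightarrow> real) \<Rightarrow> ('s \<Rightarrow> real) \<Rightarrow> 's \<Rightarrow> real" where
  "tilted_op P h \<phi> s = (\<Sum>t\<in>UNIV. P s t * (exp (h t) * \<phi> t))"

context reversible_chain begin

lemma Cauchy_Schwarz_ip: "(ip v w)\<^sup>2 \<le> ip v v * ip w w"
proof -
  have sq: "(sqrt (\<mu> s) * x) * (sqrt (\<mu> s) * y) = \<mu> s * x * y" for s x y
  proof -
    have "(sqrt (\<mu> s) * x) * (sqrt (\<mu> s) * y) = (sqrt (\<mu> s) * sqrt (\<mu> s)) * x * y"
      by (simp only: mult_ac)
    then show ?thesis using mu_pos[of s] by simp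
  qed
  show ?thesis
    using Cauchy_Schwarz_ineq_sum[of "\<lambda>s. sqrt (\<mu> s) * v s" "\<lambda>s. sqrt (\<mu> s) * w s" UNIV]
    by (simp only: ip_def sq power2_eq_square)
qed

text \<open>The gap bounds the form by \<open>(1 - g) E w^2 + g m^2\<close> with \<open>m\<close>
  the mean of \<open>w\<close>. The term \<open>g m^2\<close> is absorbed into
  \<open>E w^2 (A - h)\<close>, which leaves \<open>E w^2 (1 + \<kappa> - h)\<close>, and
  \<open>1 + x \<le> exp x\<close> finishes.\<close>

lemma tilted_form_bound:
  assumes gap: "\<And>w. ip (\<lambda>_. 1) w = 0 \<Longrightarrow> ip w (op w) \<le> (1 - g) * ip w w"
    and "0 < g" and h: "\<And>s. \<bar>h s\<bar> \<le> b" "ip (\<lambda>_. 1) h = 0"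
  shows "ip w (op w) \<le> exp (b\<^sup>2 / g) * ip w (\<lambda>s. exp (- h s) * w s)"
proof -
  define \<kappa> where "\<kappa> = b\<^sup>2 / g"
  define A where "A = g + \<kappa>"
  define m where "m = ip (\<lambda>_. 1) w"
  have "0 \<le> b" using h(1)[of undefined] by linarith
  \<comment> \<open>Equivalent to \<open>b < A\<close>, which keeps all denominators
    \<open>A - h s\<close> positive. The arithmetic-geometric inequality is strict enough only for
    \<open>b \<noteq> 0\<close>.\<close>
  have "g * b < g\<^sup>2 + b\<^sup>2"
  proof (cases "b = 0")
    case False
    then have "0 < g * b" using \<open>0 < g\<close> \<open>0 \<le> b\<close> by simp
    then show ?thesis using sum_squares_bound[of g b] by simp
  qed (use \<open>0 < g\<close> in simp)
  then have "b < A" using \<open>0 < g\<close> by (simp add: A_def \<kappa>_def field_simps power2_eq_square)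
  have hA: "0 < A - h s" for s using h(1)[of s] \<open>b < A\<close> by linarith
  have bA: "b\<^sup>2 < A\<^sup>2" using \<open>b < A\<close> \<open>0 \<le> b\<close> by (intro power_strict_mono) auto
  have frac: "g * (\<Sum>s\<in>UNIV. \<mu> s / (A - h s)) \<le> 1"
  proof -
    \<comment> \<open>The right factor is the chord of the convex function
      \<open>1 / (A - x)\<close> over \<open>[-b, b]\<close>; its linear term vanishes on averaging,
      as \<open>h\<close> has mean zero.\<close>
    have "\<mu> s / (A - h s) \<le> \<mu> s * ((A + h s) / (A\<^sup>2 - b\<^sup>2))" for s
    proof -
      have "(h s)\<^sup>2 \<le> b\<^sup>2" using h(1)[of s] \<open>0 \<le> b\<close> by (simp add: abs_le_square_iff[symmetric])
      then have "A\<^sup>2 - b\<^sup>2 \<le> (A + h s) * (A - h s)" by (simp add: power2_eq_square algebra_simps)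
      then have "1 / (A - h s) \<le> (A + h s) / (A\<^sup>2 - b\<^sup>2)"
        using hA[of s] bA by (simp add: divide_simps)
      then have "\<mu> s * (1 / (A - h s)) \<le> \<mu> s * ((A + h s) / (A\<^sup>2 - b\<^sup>2))"
        by (intro mult_left_mono less_imp_le[OF mu_pos])
      then show ?thesis by (simp only: times_divide_eq_right mult_1_right)
    qed
    then have "(\<Sum>s\<in>UNIV. \<mu> s / (A - h s)) \<le> (\<Sum>s\<in>UNIV. \<mu> s * ((A + h s) / (A\<^sup>2 - b\<^sup>2)))"
      by (intro sum_mono)
    also have "\<dots> = (\<Sum>s\<in>UNIV. \<mu> s * A + \<mu> s * h s) / (A\<^sup>2 - b\<^sup>2)"
      unfolding sum_divide_distrib by (intro sum.cong refl) (simp add: distrib_left add_divide_distrib)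
    also have "\<dots> = A / (A\<^sup>2 - b\<^sup>2)"
      using h(2) by (simp add: sum.distrib mu_total ip_def flip: sum_distrib_right)
    finally have "g * (\<Sum>s\<in>UNIV. \<mu> s / (A - h s)) \<le> g * (A / (A\<^sup>2 - b\<^sup>2))"
      using \<open>0 < g\<close> by (intro mult_left_mono) auto
    also have "\<dots> = g * A / (A\<^sup>2 - b\<^sup>2)" by simp
    also have "\<dots> \<le> 1"
    proof -
      \<comment> \<open>The choice of \<open>\<kappa>\<close> enters here, through
        \<open>b^2 = g * \<kappa>\<close>.\<close>
      have "A\<^sup>2 - b\<^sup>2 - g * A = \<kappa>\<^sup>2"
        using \<open>0 < g\<close> by (simp add: A_def \<kappa>_def field_simps power2_eq_square)
      then have "g * A \<le> A\<^sup>2 - b\<^sup>2" using zero_le_power2[of \<kappa>] by linarith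
      then show ?thesis using bA by simp
    qed
    finally show ?thesis .
  qed
  have mean: "g * m\<^sup>2 \<le> (\<Sum>s\<in>UNIV. \<mu> s * (w s)\<^sup>2 * (A - h s))"
  proof -
    \<comment> \<open>Cauchy-Schwarz in the form of a completed square. On averaging, the left side
      gives \<open>2 g m^2\<close> and the last term at most \<open>g m^2\<close>, by
      \<open>frac\<close>.\<close>
    have "2 * (g * m) * w s \<le> (w s)\<^sup>2 * (A - h s) + (g * m)\<^sup>2 / (A - h s)" for s
    proof -
      have "0 \<le> (w s * (A - h s) - g * m)\<^sup>2 / (A - h s)" using hA[of s] by simp
      also have "\<dots> = (w s)\<^sup>2 * (A - h s) + (g * m)\<^sup>2 / (A - h s) - 2 * (g * m) * w s"
        using hA[of s] by (simp add: power2_eq_square divide_simps) (simp add: algebra_simps)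
      finally show ?thesis by simp
    qed
    then have "(\<Sum>s\<in>UNIV. \<mu> s * (2 * (g * m) * w s))
        \<le> (\<Sum>s\<in>UNIV. \<mu> s * ((w s)\<^sup>2 * (A - h s) + (g * m)\<^sup>2 / (A - h s)))"
      by (intro sum_mono mult_left_mono less_imp_le[OF mu_pos])
    moreover have "(\<Sum>s\<in>UNIV. \<mu> s * (2 * (g * m) * w s)) = 2 * (g * m\<^sup>2)"
    proof -
      have "(\<Sum>s\<in>UNIV. \<mu> s * 1 * w s) = m" by (simp add: m_def ip_def)
      moreover have "(\<Sum>s\<in>UNIV. \<mu> s * (2 * (g * m) * w s)) = 2 * (g * m) * (\<Sum>s\<in>UNIV. \<mu> s * 1 * w s)"
        unfolding sum_distrib_left by (intro sum.cong refl) simp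
      ultimately have "(\<Sum>s\<in>UNIV. \<mu> s * (2 * (g * m) * w s)) = 2 * (g * m) * m" by simp
      then show ?thesis by (simp add: power2_eq_square)
    qed
    moreover have "(\<Sum>s\<in>UNIV. \<mu> s * ((w s)\<^sup>2 * (A - h s) + (g * m)\<^sup>2 / (A - h s)))
        = (\<Sum>s\<in>UNIV. \<mu> s * (w s)\<^sup>2 * (A - h s)) + g * m\<^sup>2 * (g * (\<Sum>s\<in>UNIV. \<mu> s / (A - h s)))"
      unfolding sum_distrib_left sum.distrib[symmetric]
      by (intro sum.cong refl) (simp add: distrib_left power2_eq_square)
    moreover have "g * m\<^sup>2 * (g * (\<Sum>s\<in>UNIV. \<mu> s / (A - h s))) \<le> g * m\<^sup>2"
      using mult_left_mono[OF frac, of "g * m\<^sup>2"] \<open>0 < g\<close> by simp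
    ultimately show ?thesis by linarith
  qed
  have "ip w (op w) \<le> (1 - g) * ip w w + g * m\<^sup>2"
  proof -
    \<comment> \<open>\<open>P\<close> fixes constants and preserves the mean, so centering lowers
      both forms by exactly \<open>m^2\<close>.\<close>
    define w0 where "w0 = (\<lambda>s. w s + (- m) * 1)"
    have one: "ip (\<lambda>_. 1) (\<lambda>_. 1) = 1" by (simp add: ip_def mu_total)
    have "ip (\<lambda>_. 1) w0 = 0" unfolding w0_def ip_simps by (simp add: one m_def)
    from gap[OF this] have "ip w0 (op w0) \<le> (1 - g) * ip w0 w0" .
    moreover have "ip w0 w0 = ip w w - m\<^sup>2"
      unfolding w0_def ip_simps by (simp add: one m_def ip_commute[of w "\<lambda>_. 1"] power2_eq_square)
    moreover have "ip w0 (op w0) = ip w (op w) - m\<^sup>2"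
      unfolding w0_def op_add op_scale ip_simps
      by (simp add: one m_def op_const ip_one_op ip_commute[of w "\<lambda>_. 1"] power2_eq_square)
    ultimately show ?thesis by (simp add: algebra_simps)
  qed
  also have "\<dots> \<le> (\<Sum>s\<in>UNIV. \<mu> s * (w s)\<^sup>2 * (1 + (\<kappa> - h s)))"
  proof -
    have "(1 - g) * ip w w + (\<Sum>s\<in>UNIV. \<mu> s * (w s)\<^sup>2 * (A - h s))
        = (\<Sum>s\<in>UNIV. \<mu> s * (w s)\<^sup>2 * (1 + (\<kappa> - h s)))"
      unfolding ip_def sum_distrib_left sum.distrib[symmetric]
      by (intro sum.cong refl) (simp add: A_def power2_eq_square algebra_simps)
    then show ?thesis using mean by linarith
  qed
  also have "\<dots> \<le> (\<Sum>s\<in>UNIV. \<mu> s * (w s)\<^sup>2 * exp (\<kappa> - h s))"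
    by (intro sum_mono mult_left_mono exp_ge_add_one_self mult_nonneg_nonneg less_imp_le[OF mu_pos]) simp
  also have "\<dots> = exp (b\<^sup>2 / g) * ip w (\<lambda>s. exp (- h s) * w s)"
    unfolding ip_def sum_distrib_left
    by (intro sum.cong refl) (simp add: \<kappa>_def exp_diff exp_minus divide_inverse power2_eq_square)
  finally show ?thesis .
qed

text \<open>The entries of \<open>P\<close> are nonnegative. An upper bound for the form therefore
  yields a lower bound too, by passing to absolute values.\<close>

lemma op_abs_form: "- ip w (op w) \<le> ip (\<lambda>s. \<bar>w s\<bar>) (op (\<lambda>s. \<bar>w s\<bar>))"
  unfolding ip_op sum_negf[symmetric]
proof (intro sum_mono)
  fix s t
  have "- (w s * w t) \<le> \<bar>w s\<bar> * \<bar>w t\<bar>" by (metis abs_ge_minus_self abs_mult)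
  then have "\<mu> s * P s t * - (w s * w t) \<le> \<mu> s * P s t * (\<bar>w s\<bar> * \<bar>w t\<bar>)"
    by (intro mult_left_mono mult_nonneg_nonneg P_nonneg less_imp_le[OF mu_pos])
  then show "- (\<mu> s * P s t * w s * w t) \<le> \<mu> s * P s t * \<bar>w s\<bar> * \<bar>w t\<bar>"
    by (simp add: mult.assoc)
qed

text \<open>The tilted operator is self-adjoint for the weight \<open>\<mu> exp h\<close>, so that its norm is
  governed by its quadratic form.\<close>

lemma tilted_op_norm:
  assumes form: "\<And>w. ip w (op w) \<le> r * ip w (\<lambda>s. exp (- h s) * w s)" and "0 < r"
  defines "wip \<equiv> \<lambda>v w. ip v (\<lambda>s. exp (h s) * w s)"
  shows "wip (tilted_op P h a) (tilted_op P h a) \<le> r\<^sup>2 * wip a a"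
proof -
  define T where "T a = op (\<lambda>s. exp (h s) * a s)" for a
  define B where "B a b = wip a (T b)" for a b
  have T: "tilted_op P h = T" by (simp add: tilted_op_def T_def op_def fun_eq_iff)
  have B: "B a b = ip (\<lambda>s. exp (h s) * a s) (op (\<lambda>s. exp (h s) * b s))" for a b
    by (simp add: B_def wip_def T_def) (simp add: ip_def mult_ac)
  have B_commute: "B a b = B b a" for a b unfolding B by (rule ip_op_commute)
  have upper: "B a a \<le> r * wip a a" for a
    using form[of "\<lambda>s. exp (h s) * a s"] unfolding B
    by (simp add: wip_def ip_def exp_minus mult_ac)
  have lower: "- B a a \<le> r * wip a a" for a
  proof -
    have "\<bar>x\<bar> * (\<bar>x\<bar> * y) = x * (x * y)" for x y :: real
      by (cases "0 \<le> x") auto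
    note abs = this
    show ?thesis
      using order_trans[OF op_abs_form[of "\<lambda>s. exp (h s) * a s"] form] unfolding B
      by (simp add: wip_def ip_def exp_minus mult_ac abs_mult abs)
  qed
  define b where "b = (\<lambda>s. inverse r * T a s)"
  have T_add: "T (\<lambda>s. a s + c * b s) = (\<lambda>s. T a s + c * T b s)" for a b c
    by (simp add: T_def op_def algebra_simps sum.distrib sum_distrib_left fun_eq_iff)
  have wip_add: "wip (\<lambda>s. a s + c * b s) d = wip a d + c * wip b d" 
      "wip d (\<lambda>s. a s + c * b s) = wip d a + c * wip d b" for a b c d
    by (simp_all add: wip_def ip_def algebra_simps sum.distrib sum_distrib_left)
  have wip_commute: "wip a b = wip b a" for a b by (simp add: wip_def ip_def mult_ac)
  \<comment> \<open>Polarization and the parallelogram law turn the two-sided form bound into a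
    bound on \<open>B a b\<close>. With \<open>b = T a / r\<close> this compares the norms of
    \<open>T a\<close> and \<open>a\<close>.\<close>
  have "B (\<lambda>s. a s + 1 * b s) (\<lambda>s. a s + 1 * b s) - B (\<lambda>s. a s + (-1) * b s) (\<lambda>s. a s + (-1) * b s)
      \<le> r * (wip (\<lambda>s. a s + 1 * b s) (\<lambda>s. a s + 1 * b s)
        + wip (\<lambda>s. a s + (-1) * b s) (\<lambda>s. a s + (-1) * b s))"
    using upper[of "\<lambda>s. a s + 1 * b s"] lower[of "\<lambda>s. a s + (-1) * b s"]
    unfolding distrib_left by linarith
  then have "2 * B a b + 2 * B b a \<le> r * (2 * wip a a + 2 * wip b b)"
    unfolding B_def T_add wip_add by (simp add: wip_commute[of b a] algebra_simps)
  moreover have "B b a = inverse r * wip (T a) (T a)"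
    unfolding B_def by (simp add: b_def wip_def ip_simps)
  moreover have "wip b b = (inverse r)\<^sup>2 * wip (T a) (T a)"
    by (simp add: b_def wip_def ip_def sum_distrib_left power2_eq_square mult_ac)
  ultimately have "wip (T a) (T a) / r \<le> r * wip a a"
    using \<open>0 < r\<close> by (simp add: B_commute[of a b] field_simps power2_eq_square)
  then show ?thesis unfolding T using \<open>0 < r\<close> by (simp add: field_simps power2_eq_square)
qed

text \<open>Cauchy-Schwarz pairs the density of \<open>\<nu>\<close> with the iterate in
  \<open>L^2(\<mu>)\<close>, whereas the iteration is controlled with weight
  \<open>\<mu> exp h\<close>. Changing the weight at the start and at the end costs
  \<open>exp (b / 2)\<close> each, hence the term \<open>b\<close> in the exponent.\<close>

lemma tilted_moment_bound:
  assumes gap: "\<And>w. ip (\<lambda>_. 1) w = 0 \<Longrightarrow> ip w (op w) \<le> (1 - g) * ip w w"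
    and "0 < g" and h: "\<And>s. \<bar>h s\<bar> \<le> b" "ip (\<lambda>_. 1) h = 0"
  shows "(\<Sum>s\<in>UNIV. \<nu> s * (tilted_op P h ^^ n) (\<lambda>_. 1) s)
    \<le> density_norm \<nu> \<mu> * exp (b + real n * (b\<^sup>2 / g))"
proof -
  define u where "u n = (tilted_op P h ^^ n) (\<lambda>_. 1)" for n
  define wip where "wip v w = ip v (\<lambda>s. exp (h s) * w s)" for v w
  define r where "r = exp (b\<^sup>2 / g)"
  have step: "wip (u (Suc n)) (u (Suc n)) \<le> r\<^sup>2 * wip (u n) (u n)" for n
    unfolding wip_def u_def r_def funpow.simps o_def
    by (rule tilted_op_norm[OF tilted_form_bound[OF gap \<open>0 < g\<close> h]]) auto
  have exp_le: "exp (h s) \<le> exp b" "exp (- b) \<le> exp (h s)" for s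
    using h(1)[of s] by auto
  have "wip (u n) (u n) \<le> (r ^ n)\<^sup>2 * exp b"
  proof (induction n)
    case 0
    have "wip (u 0) (u 0) \<le> (\<Sum>s\<in>UNIV. \<mu> s * exp b)"
      unfolding wip_def ip_def u_def
      by (simp, intro sum_mono mult_left_mono exp_le less_imp_le[OF mu_pos])
    then show ?case by (simp add: mu_total flip: sum_distrib_right)
  next
    case (Suc n)
    have "wip (u (Suc n)) (u (Suc n)) \<le> r\<^sup>2 * ((r ^ n)\<^sup>2 * exp b)"
      by (rule order_trans[OF step mult_left_mono[OF Suc]]) simp
    then show ?case by (simp add: power_mult_distrib mult_ac)
  qed
  moreover have "exp (- b) * ip (u n) (u n) \<le> wip (u n) (u n)"
  proof -
    have "exp (- b) * (\<mu> s * u n s * u n s) \<le> \<mu> s * u n s * (exp (h s) * u n s)" for s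
      using mult_right_mono[OF exp_le(2)[of s], of "\<mu> s * (u n s * u n s)"] mu_pos[of s]
      by (simp add: mult_ac less_imp_le)
    then show ?thesis unfolding wip_def ip_def sum_distrib_left by (intro sum_mono)
  qed
  ultimately have "exp (- b) * ip (u n) (u n) \<le> (r ^ n)\<^sup>2 * exp b" by linarith
  then have "ip (u n) (u n) \<le> (r ^ n)\<^sup>2 * exp b * exp b"
    by (simp add: exp_minus field_simps)
  then have norm_u: "ip (u n) (u n) \<le> (r ^ n * exp b)\<^sup>2"
    by (simp add: power2_eq_square mult_ac)
  define q where "q = (\<lambda>s. \<nu> s / \<mu> s)"
  have "(ip q (u n))\<^sup>2 \<le> ip q q * (r ^ n * exp b)\<^sup>2"
    by (rule order_trans[OF Cauchy_Schwarz_ip mult_left_mono[OF norm_u ip_self_nonneg]])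
  then have "\<bar>ip q (u n)\<bar> \<le> sqrt (ip q q * (r ^ n * exp b)\<^sup>2)"
    by (rule real_le_rsqrt[of "\<bar>_\<bar>", unfolded power2_abs])
  also have "\<dots> = sqrt (ip q q) * (r ^ n * exp b)"
    by (simp add: real_sqrt_mult r_def)
  also have "sqrt (ip q q) = density_norm \<nu> \<mu>"
    by (simp only: density_norm_def mean_def ip_def q_def power2_eq_square mult.assoc real_scaleR_def)
  also have "r ^ n * exp b = exp (b + real n * (b\<^sup>2 / g))"
    by (simp only: r_def exp_add exp_of_nat_mult mult.commute)
  also have "ip q (u n) = (\<Sum>s\<in>UNIV. \<nu> s * u n s)"
    using mu_pos by (simp add: ip_def q_def less_imp_neq[THEN not_sym])
  finally show ?thesis unfolding u_def by linarith
qed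

end

section \<open>Exponential moments along the chain\<close>

lemma (in prob_space) expectation_finite_range:
  fixes F :: "'b \<Rightarrow> real"
  assumes "finite A" and Z: "\<And>\<omega>. \<omega> \<in> space M \<Longrightarrow> Z \<omega> \<in> A"
    and meas: "\<And>z. z \<in> A \<Longrightarrow> {\<omega> \<in> space M. Z \<omega> = z} \<in> events"
  shows "expectation (\<lambda>\<omega>. F (Z \<omega>)) = (\<Sum>z\<in>A. F z * prob {\<omega> \<in> space M. Z \<omega> = z})"
proof -
  have "expectation (\<lambda>\<omega>. F (Z \<omega>)) =
      expectation (\<lambda>\<omega>. \<Sum>z\<in>A. F z * indicator {\<omega> \<in> space M. Z \<omega> = z} \<omega>)"
  proof (intro Bochner_Integration.integral_cong refl)
    fix \<omega> assume "\<omega> \<in> space M"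
    then have "(\<Sum>z\<in>A. F z * indicator {\<omega> \<in> space M. Z \<omega> = z} \<omega>) = (\<Sum>z\<in>A. if Z \<omega> = z then F z else 0)"
      by (intro sum.cong) auto
    then show "F (Z \<omega>) = (\<Sum>z\<in>A. F z * indicator {\<omega> \<in> space M. Z \<omega> = z} \<omega>)"
      using \<open>finite A\<close> Z[OF \<open>\<omega> \<in> space M\<close>] by simp
  qed
  also have "\<dots> = (\<Sum>z\<in>A. F z * prob {\<omega> \<in> space M. Z \<omega> = z})"
    using meas by (subst Bochner_Integration.integral_sum)
      (auto intro!: integrable_mult_right integrable_real_indicator simp: emeasure_eq_measure)
  finally show ?thesis .
qed

text \<open>The product form of the transition rule also covers histories of probability zero, where
  both sides vanish.\<close>

lemma markov_chain_step:
  assumes mc: "markov_chain M X \<mu>0 P"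
  shows "measure M {\<omega> \<in> space M. (\<forall>i\<le>n. X i \<omega> = x i) \<and> X (Suc n) \<omega> = t}
    = measure M {\<omega> \<in> space M. \<forall>i\<le>n. X i \<omega> = x i} * P (x n) t"
proof -
  interpret prob_space M using mc by (simp add: markov_chain_def)
  have [measurable]: "X i \<in> measurable M (count_space UNIV)" for i
    using mc by (simp add: markov_chain_def)
  let ?A = "{\<omega> \<in> space M. \<forall>i\<le>n. X i \<omega> = x i}"
  show ?thesis
  proof (cases "measure M ?A = 0")
    case True
    have "measure M {\<omega> \<in> space M. (\<forall>i\<le>n. X i \<omega> = x i) \<and> X (Suc n) \<omega> = t} \<le> measure M ?A"
      by (intro finite_measure_mono) auto
    then show ?thesis using True by (simp add: measure_le_0_iff)
  next
    case False
    \<comment> \<open>\<open>markov_chain\<close> takes history and next state from a single path,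
      so \<open>t\<close> is spliced in at time \<open>Suc n\<close>.\<close>
    define y where "y = x(Suc n := t)"
    have A: "?A = {\<omega> \<in> space M. \<forall>i\<le>n. X i \<omega> = y i}" by (auto simp: y_def)
    then have pos: "0 < measure M {\<omega> \<in> space M. \<forall>i\<le>n. X i \<omega> = y i}"
      using False by (simp add: zero_less_measure_iff)
    then have "cond_prob M (\<lambda>\<omega>. X (Suc n) \<omega> = y (Suc n)) (\<lambda>\<omega>. \<forall>i\<le>n. X i \<omega> = y i) = P (y n) (y (Suc n))"
      using mc unfolding markov_chain_def by blast
    then have "measure M {\<omega> \<in> space M. X (Suc n) \<omega> = y (Suc n) \<and> (\<forall>i\<le>n. X i \<omega> = y i)} =
        P (y n) (y (Suc n)) * measure M {\<omega> \<in> space M. \<forall>i\<le>n. X i \<omega> = y i}"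
      using pos unfolding cond_prob_def by (simp add: divide_eq_eq)
    moreover have "{\<omega> \<in> space M. X (Suc n) \<omega> = y (Suc n) \<and> (\<forall>i\<le>n. X i \<omega> = y i)}
        = {\<omega> \<in> space M. (\<forall>i\<le>n. X i \<omega> = x i) \<and> X (Suc n) \<omega> = t}"
      by (auto simp: y_def)
    ultimately show ?thesis unfolding A by (simp add: y_def mult.commute)
  qed
qed

text \<open>The Markov property for functions of the whole history, obtained by summing over the
  finitely many histories.\<close>

lemma markov_chain_expectation_step:
  fixes X :: "nat \<Rightarrow> 'w \<Rightarrow> 's::finite" and F :: "(nat \<Rightarrow> 's) \<Rightarrow> real"
  assumes mc: "markov_chain M X \<mu>0 P"
  shows "(\<integral>\<omega>. F (\<lambda>i\<in>{..n}. X i \<omega>) * \<psi> (X (Suc n) \<omega>) \<partial>M)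
    = (\<integral>\<omega>. F (\<lambda>i\<in>{..n}. X i \<omega>) * (\<Sum>t\<in>UNIV. P (X n \<omega>) t * \<psi> t) \<partial>M)"
proof -
  define Y where "Y \<omega> = (\<lambda>i\<in>{..n}. X i \<omega>)" for \<omega>
  interpret prob_space M using mc by (simp add: markov_chain_def)
  have [measurable]: "X i \<in> measurable M (count_space UNIV)" for i
    using mc by (simp add: markov_chain_def)
  \<comment> \<open>Restricting paths to \<open>{..n}\<close> makes the history a random variable
    with values in this finite set.\<close>
  define A where "A = PiE {..n} (\<lambda>_. UNIV :: 's set)"
  have "finite A" by (simp add: A_def finite_PiE)
  have Y_in: "Y \<omega> \<in> A" for \<omega> by (simp add: Y_def A_def)
  have Y_eq: "Y \<omega> = y \<longleftrightarrow> (\<forall>i\<le>n. X i \<omega> = y i)" if "y \<in> A" for y \<omega>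
    using that by (auto simp: Y_def A_def fun_eq_iff PiE_def extensional_def)
  have ev1: "{\<omega> \<in> space M. Y \<omega> = y} \<in> events" if "y \<in> A" for y
    unfolding Y_eq[OF that] by measurable
  have ev2: "{\<omega> \<in> space M. (Y \<omega>, X (Suc n) \<omega>) = z} \<in> events" if "z \<in> A \<times> UNIV" for z
    using that by (cases z) (auto simp: Y_eq)
  have "(\<integral>\<omega>. F (Y \<omega>) * \<psi> (X (Suc n) \<omega>) \<partial>M)
      = (\<Sum>z\<in>A \<times> UNIV. F (fst z) * \<psi> (snd z) * prob {\<omega> \<in> space M. (Y \<omega>, X (Suc n) \<omega>) = z})"
    using expectation_finite_range[of "A \<times> UNIV" "\<lambda>\<omega>. (Y \<omega>, X (Suc n) \<omega>)" "\<lambda>z. F (fst z) * \<psi> (snd z)"]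
      \<open>finite A\<close> Y_in ev2 by simp
  also have "\<dots> = (\<Sum>y\<in>A. \<Sum>t\<in>UNIV. F y * \<psi> t * (prob {\<omega> \<in> space M. Y \<omega> = y} * P (y n) t))"
    unfolding sum.cartesian_product
    by (intro sum.cong refl) (auto simp: Y_eq markov_chain_step[OF mc])
  also have "\<dots> = (\<Sum>y\<in>A. F y * (\<Sum>t\<in>UNIV. P (y n) t * \<psi> t) * prob {\<omega> \<in> space M. Y \<omega> = y})"
    by (simp add: sum_distrib_left sum_distrib_right mult_ac)
  also have "\<dots> = (\<integral>\<omega>. F (Y \<omega>) * (\<Sum>t\<in>UNIV. P (Y \<omega> n) t * \<psi> t) \<partial>M)"
    using expectation_finite_range[of A Y "\<lambda>y. F y * (\<Sum>t\<in>UNIV. P (y n) t * \<psi> t)"] \<open>finite A\<close> Y_in ev1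
    by simp
  finally show ?thesis by (simp add: Y_def)
qed

text \<open>Conditioning on the first n steps replaces the last factor by
  \<open>tilted_op P h \<phi>\<close> at time n; hence the induction generalizes over
  \<open>\<phi>\<close>.\<close>

lemma markov_chain_exponential_moment:
  assumes mc: "markov_chain M X \<mu>0 P"
  shows "(\<integral>\<omega>. exp (\<Sum>i=1..n. h (X i \<omega>)) * \<phi> (X n \<omega>) \<partial>M)
    = (\<Sum>s\<in>UNIV. \<mu>0 s * (tilted_op P h ^^ n) \<phi> s)"
proof (induction n arbitrary: \<phi>)
  case 0
  interpret prob_space M using mc by (simp add: markov_chain_def)
  have [measurable]: "X i \<in> measurable M (count_space UNIV)" for i
    using mc by (simp add: markov_chain_def)
  have "(\<integral>\<omega>. \<phi> (X 0 \<omega>) \<partial>M) = (\<Sum>s\<in>UNIV. \<phi> s * prob {\<omega> \<in> space M. X 0 \<omega> = s})"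
    by (intro expectation_finite_range) auto
  then show ?case using mc by (simp add: markov_chain_def mult.commute)
next
  case (Suc n)
  have "(\<integral>\<omega>. exp (\<Sum>i=1..Suc n. h (X i \<omega>)) * \<phi> (X (Suc n) \<omega>) \<partial>M)
      = (\<integral>\<omega>. exp (\<Sum>i=1..n. h (X i \<omega>)) * (exp (h (X (Suc n) \<omega>)) * \<phi> (X (Suc n) \<omega>)) \<partial>M)"
    by (simp add: exp_add mult_ac)
  also have "\<dots> = (\<integral>\<omega>. exp (\<Sum>i=1..n. h (X i \<omega>)) * tilted_op P h \<phi> (X n \<omega>) \<partial>M)"
    using markov_chain_expectation_step[OF mc, of "\<lambda>y. exp (\<Sum>i=1..n. h (y i))" n "\<lambda>t. exp (h t) * \<phi> t"]
    by (simp add: tilted_op_def)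
  also have "\<dots> = (\<Sum>s\<in>UNIV. \<mu>0 s * (tilted_op P h ^^ Suc n) \<phi> s)"
    unfolding Suc by (simp add: funpow_swap1)
  finally show ?case .
qed

section \<open>From exponential moments to tails of the norm\<close>

text \<open>Completing the square gives a multiple of the normal density with mean
  \<open>c / (2 * a)\<close> and variance \<open>1 / (2 * a)\<close>.\<close>

lemma nn_integral_exp_quadratic:
  fixes a c :: real
  assumes "0 < a"
  shows "(\<integral>\<^sup>+x. ennreal (exp (c * x - a * x\<^sup>2)) \<partial>lborel) = ennreal (sqrt (pi / a) * exp (c\<^sup>2 / (4 * a)))"
proof -
  define \<tau> where "\<tau> = sqrt (1 / (2 * a))"
  have \<tau>: "\<tau>\<^sup>2 = 1 / (2 * a)" "0 < \<tau>" using assms by (simp_all add: \<tau>_def)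
  let ?C = "sqrt (pi / a) * exp (c\<^sup>2 / (4 * a))"
  have "exp (c * x - a * x\<^sup>2) = ?C * normal_density (c / (2 * a)) \<tau> x" for x
  proof -
    have "c * x - a * x\<^sup>2 = c\<^sup>2 / (4 * a) + - (x - c / (2 * a))\<^sup>2 / (2 * \<tau>\<^sup>2)"
      using assms unfolding \<tau>(1) by (simp add: power2_eq_square field_simps)
    moreover have "2 * pi * \<tau>\<^sup>2 = pi / a" using assms by (simp add: \<tau>)
    ultimately show ?thesis
      using assms by (simp only: normal_density_def exp_add) simp
  qed
  then have "(\<integral>\<^sup>+x. ennreal (exp (c * x - a * x\<^sup>2)) \<partial>lborel)
      = (\<integral>\<^sup>+x. ennreal ?C * ennreal (normal_density (c / (2 * a)) \<tau> x) \<partial>lborel)"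
    using assms by (simp add: ennreal_mult')
  also have "\<dots> = ennreal ?C * (\<integral>\<^sup>+x. ennreal (normal_density (c / (2 * a)) \<tau> x) \<partial>lborel)"
    by (rule nn_integral_cmult) simp
  also have "(\<integral>\<^sup>+x. ennreal (normal_density (c / (2 * a)) \<tau> x) \<partial>lborel) = 1"
    using \<tau>(2) by (subst nn_integral_eq_integral) auto
  finally show ?thesis by simp
qed

text \<open>Integrating over the product measure instead of over vectors lets the integral factor
  into one-dimensional ones.\<close>

lemma nn_integral_exp_quadratic_vec:
  fixes x :: "real ^ 'm"
  assumes "0 < a"
  shows "(\<integral>\<^sup>+\<theta>. ennreal (exp ((\<chi> i. \<theta> i) \<bullet> x - a * (norm (\<chi> i. \<theta> i :: real ^ 'm))\<^sup>2))
      \<partial>Pi\<^sub>M (UNIV :: 'm set) (\<lambda>_. lborel))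
    = ennreal ((pi / a) powr (real CARD('m) / 2) * exp ((norm x)\<^sup>2 / (4 * a)))"
proof -
  interpret product_sigma_finite "\<lambda>_::'m. lborel :: real measure"
    by standard
  have sq: "(norm y)\<^sup>2 = (\<Sum>i\<in>UNIV. (y $ i)\<^sup>2)" for y :: "real ^ 'm"
    by (simp add: norm_vec_def L2_set_def sum_nonneg)
  have "(\<integral>\<^sup>+\<theta>. ennreal (exp ((\<chi> i. \<theta> i) \<bullet> x - a * (norm (\<chi> i. \<theta> i :: real ^ 'm))\<^sup>2))
      \<partial>Pi\<^sub>M (UNIV :: 'm set) (\<lambda>_. lborel))
    = (\<integral>\<^sup>+\<theta>. (\<Prod>i\<in>UNIV. ennreal (exp (x $ i * \<theta> i - a * (\<theta> i)\<^sup>2))) \<partial>Pi\<^sub>M UNIV (\<lambda>_. lborel))"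
    by (simp add: sq inner_vec_def prod_ennreal sum_subtractf sum_distrib_left mult.commute flip: exp_sum)
  also have "\<dots> = (\<Prod>i\<in>UNIV. ennreal (sqrt (pi / a) * exp ((x $ i)\<^sup>2 / (4 * a))))"
    by (subst product_nn_integral_prod) (simp_all add: nn_integral_exp_quadratic[OF assms])
  also have "\<dots> = ennreal (sqrt (pi / a) ^ CARD('m) * exp ((norm x)\<^sup>2 / (4 * a)))"
    using assms by (simp add: prod_ennreal prod.distrib sq sum_divide_distrib exp_sum)
  also have "sqrt (pi / a) ^ CARD('m) = (pi / a) powr (real CARD('m) / 2)"
    using assms by (simp add: powr_half_sqrt[symmetric] powr_powr flip: powr_realpow)
  finally show ?thesis .
qed

text \<open>Integrating the moment bound against the Gaussian weight \<open>exp (- 2 \<kappa> |\<theta>|\<^sup>2)\<close> turns it into a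
  bound for a Gaussian moment of the norm.\<close>

lemma (in prob_space) norm_tail_of_exponential_moments:
  fixes S :: "'a \<Rightarrow> real ^ 'm"
  assumes [measurable]: "S \<in> borel_measurable M"
    and "0 < \<kappa>" "0 \<le> r" "0 \<le> C"
    and moment: "\<And>\<theta>. (\<integral>\<^sup>+\<omega>. ennreal (exp (\<theta> \<bullet> S \<omega>)) \<partial>M) \<le> ennreal (C * exp (\<kappa> * (norm \<theta>)\<^sup>2))"
  shows "prob {\<omega> \<in> space M. r \<le> norm (S \<omega>)} \<le> C * 2 powr (real CARD('m) / 2) * exp (- r\<^sup>2 / (8 * \<kappa>))"
proof -
  interpret P: product_sigma_finite "\<lambda>_::'m. lborel :: real measure"
    by standard
  let ?L = "Pi\<^sub>M (UNIV :: 'm set) (\<lambda>_. lborel :: real measure)"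
  interpret L: sigma_finite_measure ?L by (rule P.sigma_finite) simp
  interpret pair_sigma_finite M ?L ..
  let ?d = "real CARD('m) / 2"
  define v :: "('m \<Rightarrow> real) \<Rightarrow> real ^ 'm" where "v = vec_lambda"
  have v_eq: "(\<chi> i. \<theta> i) = v \<theta>" for \<theta> by (simp add: v_def)
  have [measurable]: "v \<in> borel_measurable ?L"
    unfolding borel_measurable_euclidean_space[where f = v]
    by (auto simp: Basis_vec_def inner_axis v_def)
  \<comment> \<open>The Gaussian integral with parameter \<open>2 * \<kappa>\<close> is read
    backwards: it represents the exponential of the squared norm as an average of exponentials
    linear in \<open>S\<close>.\<close>
  have "ennreal ((pi / (2 * \<kappa>)) powr ?d) * (\<integral>\<^sup>+\<omega>. ennreal (exp (1 / (8 * \<kappa>) * (norm (S \<omega>))\<^sup>2)) \<partial>M)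
      = (\<integral>\<^sup>+\<omega>. ennreal ((pi / (2 * \<kappa>)) powr ?d * exp ((norm (S \<omega>))\<^sup>2 / (4 * (2 * \<kappa>)))) \<partial>M)"
    by (simp add: ennreal_mult' nn_integral_cmult)
  also have "\<dots> = (\<integral>\<^sup>+\<omega>. (\<integral>\<^sup>+\<theta>. ennreal (exp (v \<theta> \<bullet> S \<omega> - 2 * \<kappa> * (norm (v \<theta>))\<^sup>2)) \<partial>?L) \<partial>M)"
    using nn_integral_exp_quadratic_vec[where a = "2 * \<kappa>" and 'm = 'm] \<open>0 < \<kappa>\<close> by (simp add: v_eq)
  also have "\<dots> = (\<integral>\<^sup>+\<theta>. (\<integral>\<^sup>+\<omega>. ennreal (exp (v \<theta> \<bullet> S \<omega> - 2 * \<kappa> * (norm (v \<theta>))\<^sup>2)) \<partial>M) \<partial>?L)"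
    by (rule Fubini'[symmetric]) measurable
  \<comment> \<open>Half of the Gaussian weight absorbs the growth of the moment. The remaining half
    is kept with \<open>v \<theta> \<bullet> 0\<close> so that it is the Gaussian integral at
    \<open>x = 0\<close>.\<close>
  also have "\<dots> \<le> (\<integral>\<^sup>+\<theta>. ennreal C * ennreal (exp (v \<theta> \<bullet> 0 - \<kappa> * (norm (v \<theta>))\<^sup>2)) \<partial>?L)"
  proof (intro nn_integral_mono)
    fix \<theta>
    let ?q = "exp (- 2 * \<kappa> * (norm (v \<theta>))\<^sup>2)"
    have "(\<integral>\<^sup>+\<omega>. ennreal (exp (v \<theta> \<bullet> S \<omega> - 2 * \<kappa> * (norm (v \<theta>))\<^sup>2)) \<partial>M)
        = (\<integral>\<^sup>+\<omega>. ennreal ?q * ennreal (exp (v \<theta> \<bullet> S \<omega>)) \<partial>M)"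
      by (simp flip: ennreal_mult' exp_add)
    also have "\<dots> = ennreal ?q * (\<integral>\<^sup>+\<omega>. ennreal (exp (v \<theta> \<bullet> S \<omega>)) \<partial>M)"
      by (rule nn_integral_cmult) measurable
    also have "\<dots> \<le> ennreal ?q * ennreal (C * exp (\<kappa> * (norm (v \<theta>))\<^sup>2))"
      by (intro mult_left_mono moment) simp
    also have "\<dots> = ennreal C * ennreal (exp (v \<theta> \<bullet> 0 - \<kappa> * (norm (v \<theta>))\<^sup>2))"
      using \<open>0 \<le> C\<close> by (simp add: mult_ac flip: ennreal_mult' exp_add)
    finally show "(\<integral>\<^sup>+\<omega>. ennreal (exp (v \<theta> \<bullet> S \<omega> - 2 * \<kappa> * (norm (v \<theta>))\<^sup>2)) \<partial>M)
        \<le> ennreal C * ennreal (exp (v \<theta> \<bullet> 0 - \<kappa> * (norm (v \<theta>))\<^sup>2))" .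
  qed
  also have "\<dots> = ennreal (C * (pi / \<kappa>) powr ?d)"
    using nn_integral_exp_quadratic_vec[of \<kappa> "0 :: real ^ 'm"] \<open>0 < \<kappa>\<close> \<open>0 \<le> C\<close>
    by (subst nn_integral_cmult) (simp_all add: v_eq ennreal_mult')
  \<comment> \<open>The ratio of the normalizing constants for \<open>\<kappa>\<close> and
    \<open>2 * \<kappa>\<close> is the dimensional factor.\<close>
  also have "\<dots> = ennreal ((pi / (2 * \<kappa>)) powr ?d) * ennreal (C * 2 powr ?d)"
  proof -
    have "(pi / \<kappa>) powr ?d = (pi / (2 * \<kappa>)) powr ?d * 2 powr ?d"
      using \<open>0 < \<kappa>\<close> by (simp flip: powr_mult)
    then have *: "C * (pi / \<kappa>) powr ?d = (pi / (2 * \<kappa>)) powr ?d * (C * 2 powr ?d)"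
      by simp
    show ?thesis unfolding * by (rule ennreal_mult') simp
  qed
  finally have bound: "(\<integral>\<^sup>+\<omega>. ennreal (exp (1 / (8 * \<kappa>) * (norm (S \<omega>))\<^sup>2)) \<partial>M) \<le> ennreal (C * 2 powr ?d)"
    using \<open>0 < \<kappa>\<close> by (subst (asm) ennreal_mult_le_mult_iff) auto
  have "emeasure M {\<omega> \<in> space M. r \<le> norm (S \<omega>)} = emeasure M {\<omega> \<in> space M. r\<^sup>2 \<le> (norm (S \<omega>))\<^sup>2}"
    using \<open>0 \<le> r\<close> by (intro arg_cong[where f = "emeasure M"]) (auto simp: abs_le_square_iff[symmetric])
  also have "\<dots> \<le> ennreal (exp (- (1 / (8 * \<kappa>)) * r\<^sup>2)) *
      (\<integral>\<^sup>+\<omega>. ennreal (exp (1 / (8 * \<kappa>) * (norm (S \<omega>))\<^sup>2)) * indicator (space M) \<omega> \<partial>M)"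
    using \<open>0 < \<kappa>\<close> by (intro Chernoff_ineq_nn_integral_ge) auto
  also have "(\<integral>\<^sup>+\<omega>. ennreal (exp (1 / (8 * \<kappa>) * (norm (S \<omega>))\<^sup>2)) * indicator (space M) \<omega> \<partial>M)
      = (\<integral>\<^sup>+\<omega>. ennreal (exp (1 / (8 * \<kappa>) * (norm (S \<omega>))\<^sup>2)) \<partial>M)"
    by (intro nn_integral_cong) simp
  also have "ennreal (exp (- (1 / (8 * \<kappa>)) * r\<^sup>2)) * \<dots>
      \<le> ennreal (exp (- (1 / (8 * \<kappa>)) * r\<^sup>2)) * ennreal (C * 2 powr ?d)"
    by (intro mult_left_mono bound) simp
  also have "\<dots> = ennreal (C * 2 powr ?d * exp (- r\<^sup>2 / (8 * \<kappa>)))"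
    unfolding mult.commute[of "C * _"] using \<open>0 < \<kappa>\<close> by (subst ennreal_mult'[symmetric]) simp_all
  finally show ?thesis
    using \<open>0 \<le> C\<close> by (simp add: emeasure_eq_measure)
qed

section \<open>Choice of the constants and the tail bound\<close>

theorem theorem1:
  fixes P :: "'s::finite \<Rightarrow> 's \<Rightarrow> real"
    and \<mu> \<mu>0 :: "'s \<Rightarrow> real"
    and f :: "'s \<Rightarrow> real ^ 'm"
    and M :: "'w measure"
    and X :: "nat \<Rightarrow> 'w \<Rightarrow> 's"
    and g L \<sigma> \<epsilon> k :: real
    and N :: nat
  assumes "CARD('s) \<ge> 2"
    and "stochastic_matrix P"
    and "invariant_distribution P \<mu>"
    and "\<And>s. \<mu> s > 0"
    and "probability_vector \<mu>0"
    and "markov_chain M X \<mu>0 P"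
    and "reversible P \<mu>"
    and "decreasing_eigenvalues P ! 1 < 1"
    and "g = spectral_gap P"
    and "mean \<mu> f = 0"
    and "L > 0"
    and "sup_norm f \<le> L"
    and "principal_variance \<mu> f \<le> \<sigma>\<^sup>2"
    and "\<epsilon> > 0"
    and "N \<ge> 1"
    and "k = \<sigma>\<^sup>2 * (1 / 2 + 1 / g) + L\<^sup>2 * (192 / 125) * (g / (ln (1 + g / 2))\<^sup>2)"
  shows "measure M {\<omega> \<in> space M. norm (\<Sum>t=1..N. f (X t \<omega>)) \<ge> \<epsilon> * real N}
    \<le> 3 * density_norm \<mu>0 \<mu> * 2 powr (real CARD('m) / 2) * exp (- (1 / (8 * k)) * \<epsilon>\<^sup>2 * real N)"
proof -
  have g: "g = 1 - decreasing_eigenvalues P ! 1"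
    using assms(9) by (simp add: spectral_gap_def)
  have "0 < g" using assms(8) g by simp
  interpret reversible_chain P \<mu>
    using assms(2,3,4,7)
    by unfold_locales
      (auto simp: stochastic_matrix_def invariant_distribution_def probability_vector_def reversible_def)
  have "g \<le> 2" using spectral_gap_le_2[OF assms(1)] assms(9) by simp
  have gap: "ip w (op w) \<le> (1 - g) * ip w w" if "ip (\<lambda>_. 1) w = 0" for w
    using rayleigh_le_second_eigenvalue[OF assms(1) that] by (simp add: g)
  interpret M: prob_space M using assms(6) by (simp add: markov_chain_def)
  have [measurable]: "X t \<in> measurable M (count_space UNIV)" for t
    using assms(6) by (simp add: markov_chain_def)
  have [measurable]: "(\<lambda>\<omega>. f (X t \<omega>)) \<in> borel_measurable M" for t
    by (rule measurable_compose[of "X t" M "count_space UNIV"]) simp_all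
  have f_le: "norm (f s) \<le> L" for s
    using cSUP_upper[of s UNIV "\<lambda>s. norm (f s)"] assms(12) unfolding sup_norm_def by fastforce
  \<comment> \<open>Since \<open>ln (1 + g / 2) \<le> g / 2\<close>, the last factor in
    \<open>k\<close> is at least \<open>4 / g\<close>, and \<open>192 / 125 * 4\<close> exceeds 2;
    the term with \<open>\<sigma>\<close> is nonnegative.\<close>
  have k_ge: "2 * L\<^sup>2 / g \<le> k"
  proof -
    have "0 < ln (1 + g / 2)" "ln (1 + g / 2) \<le> g / 2"
      using \<open>0 < g\<close> ln_add_one_self_le_self[of "g / 2"] by auto
    then have "0 < (ln (1 + g / 2))\<^sup>2" "(ln (1 + g / 2))\<^sup>2 \<le> (g / 2)\<^sup>2"
      by (auto intro: power_mono)
    then have "g / (g / 2)\<^sup>2 \<le> g / (ln (1 + g / 2))\<^sup>2"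
      using \<open>0 < g\<close> by (intro divide_left_mono) auto
    moreover have "g / (g / 2)\<^sup>2 = 4 / g"
      using \<open>0 < g\<close> by (simp add: power2_eq_square field_simps)
    ultimately have "192 / 125 * (4 / g) \<le> 192 / 125 * (g / (ln (1 + g / 2))\<^sup>2)"
      by (intro mult_left_mono) simp_all
    moreover have "2 / g \<le> 192 / 125 * (4 / g)" using \<open>0 < g\<close> by (simp add: divide_simps)
    ultimately have "2 / g \<le> 192 / 125 * (g / (ln (1 + g / 2))\<^sup>2)" by (rule order_trans[rotated])
    then have "L\<^sup>2 * (2 / g) \<le> L\<^sup>2 * (192 / 125 * (g / (ln (1 + g / 2))\<^sup>2))"
      by (rule mult_left_mono) simp
    moreover have "0 \<le> \<sigma>\<^sup>2 * (1 / 2 + 1 / g)" using \<open>0 < g\<close> by simp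
    ultimately show ?thesis unfolding assms(16) by (simp add: mult_ac)
  qed
  moreover have "0 < 2 * L\<^sup>2 / g" using \<open>0 < g\<close> assms(11) by simp
  ultimately have "0 < k" by linarith
  let ?S = "\<lambda>\<omega>. \<Sum>t=1..N. f (X t \<omega>)"
  let ?D = "density_norm \<mu>0 \<mu>"
  have "0 \<le> ?D"
    unfolding density_norm_def mean_def
    by (intro real_sqrt_ge_zero sum_nonneg) (simp add: less_imp_le[OF assms(4)])
  have moment: "(\<integral>\<^sup>+\<omega>. ennreal (exp (\<theta> \<bullet> ?S \<omega>)) \<partial>M)
      \<le> ennreal (3 * ?D * exp (k * real N * (norm \<theta>)\<^sup>2))" for \<theta>
  proof -
    define h where "h s = \<theta> \<bullet> f s" for s
    define b where "b = L * norm \<theta>"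
    have h_le: "\<bar>h s\<bar> \<le> b" for s
    proof -
      have "\<bar>h s\<bar> \<le> norm \<theta> * norm (f s)" unfolding h_def by (rule Cauchy_Schwarz_ineq2)
      also have "\<dots> \<le> norm \<theta> * L" by (intro mult_left_mono f_le) simp
      finally show ?thesis by (simp add: b_def mult.commute)
    qed
    have "ip (\<lambda>_. 1) h = \<theta> \<bullet> mean \<mu> f" by (simp add: ip_def h_def mean_def inner_sum_right)
    then have h_mean: "ip (\<lambda>_. 1) h = 0" using assms(10) by simp
    have S: "\<theta> \<bullet> ?S \<omega> = (\<Sum>t=1..N. h (X t \<omega>))" for \<omega> by (simp add: h_def inner_sum_right)
    have "\<theta> \<bullet> ?S \<omega> \<le> real N * b" for \<omega>
      unfolding S using sum_bounded_above[of "{1..N}" "\<lambda>t. h (X t \<omega>)" b] abs_le_D1[OF h_le] by simp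
    then have "integrable M (\<lambda>\<omega>. exp (\<theta> \<bullet> ?S \<omega>))"
      by (intro M.integrable_const_bound[of _ "exp (real N * b)"]) auto
    then have nn: "(\<integral>\<^sup>+\<omega>. ennreal (exp (\<theta> \<bullet> ?S \<omega>)) \<partial>M) = ennreal (\<integral>\<omega>. exp (\<theta> \<bullet> ?S \<omega>) \<partial>M)"
      by (intro nn_integral_eq_integral) auto
    have "(\<integral>\<omega>. exp (\<theta> \<bullet> ?S \<omega>) \<partial>M) = (\<Sum>s\<in>UNIV. \<mu>0 s * (tilted_op P h ^^ N) (\<lambda>_. 1) s)"
      unfolding S using markov_chain_exponential_moment[OF assms(6), of h N "\<lambda>_. 1"] by simp
    also have "\<dots> \<le> ?D * exp (b + real N * (b\<^sup>2 / g))"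
      by (rule tilted_moment_bound[OF gap \<open>0 < g\<close> h_le h_mean])
    also have "\<dots> \<le> ?D * (3 * exp (k * real N * (norm \<theta>)\<^sup>2))"
    proof (intro mult_left_mono)
      \<comment> \<open>The boundary term \<open>b\<close> is at most \<open>1 + c\<close>, as
        \<open>g \<le> 2\<close>. The 1 becomes the factor \<open>exp 1 \<le> 3\<close>. As
        \<open>N \<ge> 1\<close>, the extra \<open>c\<close> is at most \<open>N * c\<close>, and
        \<open>k_ge\<close> bounds \<open>2 * c\<close>.\<close>
      define c where "c = b\<^sup>2 / g"
      have "b \<le> 1 + b\<^sup>2 / 2"
        using zero_le_power2[of "b - 1"] by (simp add: power2_eq_square algebra_simps)
      moreover have "b\<^sup>2 / 2 \<le> c"
        unfolding c_def using \<open>0 < g\<close> \<open>g \<le> 2\<close> by (intro divide_left_mono) auto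
      moreover have "c \<le> real N * c"
        using assms(15) \<open>0 < g\<close> mult_right_mono[of 1 "real N" c] by (simp add: c_def)
      moreover have "real N * (2 * c) \<le> real N * (k * (norm \<theta>)\<^sup>2)"
        using mult_right_mono[OF k_ge, of "(norm \<theta>)\<^sup>2"]
        by (intro mult_left_mono) (simp_all add: c_def b_def power_mult_distrib)
      ultimately have "b + real N * c \<le> 1 + real N * (k * (norm \<theta>)\<^sup>2)" by linarith
      then have "b + real N * (b\<^sup>2 / g) \<le> 1 + k * real N * (norm \<theta>)\<^sup>2"
        by (simp add: c_def mult.commute mult.left_commute)
      then have "exp (b + real N * (b\<^sup>2 / g)) \<le> exp 1 * exp (k * real N * (norm \<theta>)\<^sup>2)"
        by (simp flip: exp_add)
      also have "\<dots> \<le> 3 * exp (k * real N * (norm \<theta>)\<^sup>2)"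
        by (intro mult_right_mono exp_le) simp
      finally show "exp (b + real N * (b\<^sup>2 / g)) \<le> 3 * exp (k * real N * (norm \<theta>)\<^sup>2)" .
    qed (fact \<open>0 \<le> ?D\<close>)
    finally show ?thesis unfolding nn mult.left_commute[of ?D 3] mult.assoc[of 3]
      by (rule ennreal_leI)
  qed
  \<comment> \<open>The tail lemma is used with \<open>k * real N\<close> for
    \<open>\<kappa>\<close> and \<open>\<epsilon> * real N\<close> for \<open>r\<close>; one factor
    \<open>N\<close> cancels in the exponent.\<close>
  have "measure M {\<omega> \<in> space M. \<epsilon> * real N \<le> norm (?S \<omega>)}
      \<le> 3 * ?D * 2 powr (real CARD('m) / 2) * exp (- (\<epsilon> * real N)\<^sup>2 / (8 * (k * real N)))"
    using \<open>0 < k\<close> \<open>0 \<le> ?D\<close> assms(14,15)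
    by (intro M.norm_tail_of_exponential_moments moment) auto
  also have "- (\<epsilon> * real N)\<^sup>2 / (8 * (k * real N)) = - (1 / (8 * k)) * \<epsilon>\<^sup>2 * real N"
    using \<open>0 < k\<close> assms(15) by (simp add: power2_eq_square)
  finally show ?thesis .
qed

end
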